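(* Consider a graph in which each node has a single embedding vector, written $\vec{u}$ for node $u$ and $\vec{v}$ for node $v$. Let the embedding objective be $$J=\mathbb{E}_{(u,v)\sim p_d}\log\sigma(\vec{u}^{\top}\vec{v})+\mathbb{E}_{v\sim p_d(v)}\big[k\,\mathbb{E}_{u'\sim p_n(u'\mid v)}\log\sigma(-\vec{u'}^{\top}\vec{v})\big]$$ $$=\mathbb{E}_{v\sim p_d(v)}\Big[\mathbb{E}_{u\sim p_d(u\mid v)}\log\sigma(\vec{u}^{\top}\vec{v})+k\,\mathbb{E}_{u'\sim p_n(u'\mid v)}\log\sigma(-\vec{u'}^{\top}\vec{v})\Big].$$ Then the optimal embedding (the one maximizing $J$) satisfies that for each node pair $(u,v)$, $$\vec{u}^{\top}\vec{v}=-\log\frac{k\cdot p_n(u\mid v)}{p_d(u\mid v)}.$$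
   Context: $\sigma(x)=\frac{1}{1+e^{-x}}$ is the sigmoid function. $p_d(u,v)$ is the underlying positive (data) distribution on node pairs, with marginal $p_d(v)$ and conditional $p_d(u\mid v)$; $p_n(u\mid v)$ is the negative sampling distribution given node $v$; $k$ is the number of negative samples per positive sample. The objective is considered separately for each node $v$.
   Formalization: The formula is proved for maximizers of one node's objective, and for maximizers of J if one embedding is optimal for all nodes at once; only for pairs with p_d(u,v), p_n(u|v) > 0 and, when u=v, k p_n(v|v) ≤ p_d(v|v). Without these it is false (one node, k=2). *)

theory Defs
  imports "HOL-Probability.Probability"
begin

definition sigmoid :: "real \<Rightarrow> real" where
  "sigmoid x = 1 / (1 + exp (- x))"

text \<open>
  Node pairs \<open>(u, v)\<close> are drawn from a joint distribution \<open>pd\<close>; the second component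
  is the node that is conditioned on.
\<close>

definition node_marginal :: "('a \<times> 'a) pmf \<Rightarrow> 'a pmf" where
  "node_marginal pd = map_pmf snd pd"

text \<open>
  \<open>p\<^sub>d(u | v)\<close> as a distribution in \<open>u\<close>. As with \<^const>\<open>cond_pmf\<close>, this is meaningful only for
  \<open>v\<close> of positive marginal probability.
\<close>

definition node_conditional :: "('a \<times> 'a) pmf \<Rightarrow> 'a \<Rightarrow> 'a pmf" where
  "node_conditional pd v = map_pmf fst (cond_pmf pd {w. snd w = v})"

text \<open>An embedding \<open>X\<close> assigns one single vector to every node.\<close>

definition objective ::
  "('a \<times> 'a) pmf \<Rightarrow> ('a \<Rightarrow> 'a pmf) \<Rightarrow> nat \<Rightarrow> ('a \<Rightarrow> real ^ 'd) \<Rightarrow> real" where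
  "objective pd pn k X =
     measure_pmf.expectation pd (\<lambda>(u, v). ln (sigmoid (X u \<bullet> X v))) +
     measure_pmf.expectation (node_marginal pd) (\<lambda>v.
       real k * measure_pmf.expectation (pn v) (\<lambda>u'. ln (sigmoid (- (X u' \<bullet> X v)))))"

text \<open>The bracket inside the outer expectation over \<open>v\<close>: the objective for the single node \<open>v\<close>.\<close>

definition node_objective ::
  "('a \<times> 'a) pmf \<Rightarrow> ('a \<Rightarrow> 'a pmf) \<Rightarrow> nat \<Rightarrow> 'a \<Rightarrow> ('a \<Rightarrow> real ^ 'd) \<Rightarrow> real" where
  "node_objective pd pn k v X =
     measure_pmf.expectation (node_conditional pd v) (\<lambda>u. ln (sigmoid (X u \<bullet> X v))) +
     real k * measure_pmf.expectation (pn v) (\<lambda>u'. ln (sigmoid (- (X u' \<bullet> X v))))"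

definition maximizes :: "('b \<Rightarrow> real) \<Rightarrow> 'b \<Rightarrow> bool" where
  "maximizes f x \<longleftrightarrow> is_arg_max f (\<lambda>_. True) x"

text \<open>
  The objective can be maximized separately for each node: one and the same embedding is optimal
  for the objectives of all nodes simultaneously. In general this can fail, since the vectors are
  shared between the nodes and the scores \<open>X u \<bullet> X v\<close> are symmetric and of bounded rank.
\<close>

definition separately_maximizable ::
  "('a \<times> 'a) pmf \<Rightarrow> ('a \<Rightarrow> 'a pmf) \<Rightarrow> nat \<Rightarrow> 'd::finite itself \<Rightarrow> bool" where
  "separately_maximizable pd pn k _ \<longleftrightarrow>
     (\<exists>Y :: 'a \<Rightarrow> real ^ 'd. \<forall>v \<in> set_pmf (node_marginal pd).
        maximizes (node_objective pd pn k v) Y)"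

text \<open>
  The pairs for which the optimal score is a real number that an inner product can take:
  both probabilities are positive, so that the logarithm is defined, and for \<open>u = v\<close> the
  optimal score is nonnegative, because it is to equal \<open>X v \<bullet> X v\<close>. Note that
  \<open>(u, v) \<in> set_pmf pd\<close> says that \<open>v\<close> has positive marginal probability and
  \<open>p\<^sub>d(u | v) > 0\<close>.
\<close>

definition admissible_pair ::
  "('a \<times> 'a) pmf \<Rightarrow> ('a \<Rightarrow> 'a pmf) \<Rightarrow> nat \<Rightarrow> 'a \<Rightarrow> 'a \<Rightarrow> bool" where
  "admissible_pair pd pn k u v \<longleftrightarrow>
     (u, v) \<in> set_pmf pd \<and> u \<in> set_pmf (pn v) \<and>
     (u = v \<longrightarrow> real k * pmf (pn v) u \<le> pmf (node_conditional pd v) u)"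

end

theory Submission
  imports Defs
begin

text \<open>
  For a fixed node \<open>v\<close> the objective is a sum over \<open>u\<close> of functions
  \<open>a ln (sigmoid s) + b ln (sigmoid (- s))\<close> of the scores \<open>s = X u \<bullet> X v\<close>, each of which has the
  unique maximizer \<open>s = - ln (b / a)\<close> by Gibbs' inequality. Every score vector whose \<open>v\<close>-entry is
  positive is realized by collinear embedding vectors, and one whose \<open>v\<close>-entry is zero is a limit
  of these. So a maximizer cannot be improved by changing the single score of an admissible pair.
\<close>

lemma sigmoid_pos: "0 < sigmoid x"
  by (simp add: sigmoid_def add_pos_pos)

lemma sigmoid_minus: "sigmoid (- x) = 1 - sigmoid x"
proof -
  have "1 + exp x \<noteq> 0" by (metis add_pos_pos exp_gt_zero less_irrefl zero_less_one)
  then show ?thesis by (simp add: sigmoid_def exp_minus divide_simps)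
qed

lemma sigmoid_less_1: "sigmoid x < 1"
  using sigmoid_pos[of "- x"] by (simp add: sigmoid_minus)

text \<open>The logit in the form \<open>- ln (1 / p - 1)\<close>, so that
  \<open>p = a / (a + b)\<close> turns the odds against \<open>p\<close> into
  \<open>b / a\<close>.\<close>

lemma sigmoid_eq_iff: "sigmoid x = p \<longleftrightarrow> x = - ln (1 / p - 1)" if "0 < p" "p < 1"
proof
  assume "sigmoid x = p"
  then have "1 / p = 1 + exp (- x)" by (auto simp: sigmoid_def)
  then show "x = - ln (1 / p - 1)" by simp
next
  assume "x = - ln (1 / p - 1)"
  moreover have "1 / p - 1 > 0" using that by simp
  ultimately show "sigmoid x = p" by (simp add: sigmoid_def)
qed

lemma continuous_on_sigmoid [continuous_intros]:
  assumes "continuous_on S f"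
  shows "continuous_on S (\<lambda>x. sigmoid (f x))"
proof -
  have "1 + exp (- y) \<noteq> 0" for y :: real
    by (metis add_pos_pos exp_gt_zero less_irrefl zero_less_one)
  then show ?thesis
    unfolding sigmoid_def by (intro continuous_intros assms) auto
qed

text \<open>Despite its name a quantity to be maximized: the negative of an unnormalized binary
  cross-entropy.\<close>

definition pair_loss :: "real \<Rightarrow> real \<Rightarrow> real \<Rightarrow> real" where
  "pair_loss a b s = a * ln (sigmoid s) + b * ln (sigmoid (- s))"

lemma continuous_on_pair_loss:
  assumes "continuous_on S f"
  shows "continuous_on S (\<lambda>x. pair_loss a b (f x))"
  unfolding pair_loss_def
  by (intro continuous_intros assms) (auto simp: less_imp_neq[OF sigmoid_pos, symmetric])

text \<open>After normalizing the weights this is positivity of the relative entropy of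
  (\<open>p\<close>, \<open>1 - p\<close>) with respect to (\<open>q\<close>, \<open>1 - q\<close>),
  which follows from \<open>ln x \<le> x - 1\<close>; equality there needs \<open>x = 1\<close>, so
  one strict term suffices.\<close>

lemma pair_loss_less_max:
  assumes "0 < a" "0 < b" "s \<noteq> - ln (b / a)"
  shows "pair_loss a b s < pair_loss a b (- ln (b / a))"
proof -
  define p where "p = a / (a + b)"
  define q where "q = sigmoid s"
  have p: "0 < p" "p < 1" using assms by (auto simp: p_def)
  have q: "0 < q" "q < 1" by (auto simp: q_def sigmoid_pos sigmoid_less_1)
  have odds: "1 / p - 1 = b / a" using assms by (simp add: p_def field_simps)
  have sp: "sigmoid (- ln (b / a)) = p"
    by (simp add: sigmoid_eq_iff p odds)
  have "q \<noteq> p" using assms by (simp add: q_def sigmoid_eq_iff p odds)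
  then have "q / p \<noteq> 1" using p by simp
  moreover have "0 < q / p" using p q by simp
  ultimately have "ln (q / p) < q / p - 1"
    using ln_le_minus_one[of "q / p"] ln_eq_minus_one[of "q / p"] by fastforce
  moreover have "ln ((1 - q) / (1 - p)) \<le> (1 - q) / (1 - p) - 1"
    using p q by (intro ln_le_minus_one) simp
  ultimately have "a * ln (q / p) + b * ln ((1 - q) / (1 - p))
      < a * (q / p - 1) + b * ((1 - q) / (1 - p) - 1)"
    using assms by (intro add_less_le_mono mult_strict_left_mono mult_left_mono) auto
  \<comment> \<open>Both distributions have mass one, so the two terms
    \<open>(a + b) * (q - p)\<close> and \<open>(a + b) * (p - q)\<close> cancel.\<close>
  also have "\<dots> = 0"
  proof -
    have "a = (a + b) * p" "b = (a + b) * (1 - p)" using assms by (simp_all add: p_def field_simps)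
    moreover have "(a + b) * p * (q / p - 1) + (a + b) * (1 - p) * ((1 - q) / (1 - p) - 1) = 0"
      using p by (simp add: field_simps)
    ultimately show ?thesis by metis
  qed
  finally have "a * ln q + b * ln (1 - q) < a * ln p + b * ln (1 - p)"
    using p q by (simp add: ln_div algebra_simps)
  then show ?thesis
    unfolding pair_loss_def sigmoid_minus[of s] sigmoid_minus[of "- ln (b / a)"] sp q_def .
qed

text \<open>All vectors are multiples of one unit vector, with factor \<open>sqrt (S v)\<close> at
  \<open>v\<close>. If \<open>S v\<close> were zero, \<open>Y v\<close> would vanish and force every
  score to be zero.\<close>

lemma exists_embedding_of_scores:
  fixes S :: "'a \<Rightarrow> real"
  assumes "0 < S v"
  obtains Y :: "'a \<Rightarrow> 'b::euclidean_space" where "\<And>w. Y w \<bullet> Y v = S w"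
proof -
  obtain e :: 'b where e: "e \<in> Basis" using nonempty_Basis by blast
  show ?thesis
  proof
    fix w
    show "(S w / sqrt (S v)) *\<^sub>R e \<bullet> (S v / sqrt (S v)) *\<^sub>R e = S w"
      using assms e by simp
  qed
qed

lemma node_objective_eq_sum:
  fixes pd :: "('a::finite \<times> 'a) pmf" and X :: "'a \<Rightarrow> real ^ 'd::finite"
  shows "node_objective pd pn k v X =
    (\<Sum>w\<in>UNIV. pair_loss (pmf (node_conditional pd v) w) (real k * pmf (pn v) w) (X w \<bullet> X v))"
  by (simp add: node_objective_def pair_loss_def integral_measure_pmf[of UNIV]
      sum.distrib sum_distrib_left mult.assoc)

text \<open>The scores \<open>S\<close> need not be realizable when \<open>S v = 0\<close>; raising
  that one entry by \<open>t > 0\<close> makes them so, and continuity carries the bound to the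
  limit.\<close>

lemma sum_pair_loss_le_maximum:
  fixes pd :: "('a::finite \<times> 'a) pmf" and X :: "'a \<Rightarrow> real ^ 'd::finite"
  assumes max: "maximizes (node_objective pd pn k v) X" and S: "0 \<le> S v"
  shows "(\<Sum>w\<in>UNIV. pair_loss (pmf (node_conditional pd v) w) (real k * pmf (pn v) w) (S w))
    \<le> node_objective pd pn k v X"
proof -
  define G where "G S = (\<Sum>w\<in>UNIV.
    pair_loss (pmf (node_conditional pd v) w) (real k * pmf (pn v) w) (S w))" for S
  have pos: "G T \<le> node_objective pd pn k v X" if T: "0 < T v" for T
  proof -
    obtain Y :: "'a \<Rightarrow> real ^ 'd" where "\<And>w. Y w \<bullet> Y v = T w"
      using exists_embedding_of_scores[of T v, OF T] by blast
    then have "G T = node_objective pd pn k v Y" by (simp add: G_def node_objective_eq_sum)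
    then show ?thesis using max by (auto simp: maximizes_def is_arg_max_def not_less)
  qed
  have "continuous_on UNIV (\<lambda>t. (S(v := S v + t)) w)" for w
    by (cases "w = v") (auto intro!: continuous_intros)
  then have "continuous_on UNIV (\<lambda>t. G (S(v := S v + t)))"
    unfolding G_def by (intro continuous_on_sum continuous_on_pair_loss)
  then have "((\<lambda>t. G (S(v := S v + t))) \<longlongrightarrow> G (S(v := S v + 0))) (at_right 0)"
    by (metis UNIV_I continuous_on_def tendsto_within_subset subset_UNIV)
  moreover have "\<forall>\<^sub>F t in at_right (0::real). G (S(v := S v + t)) \<le> node_objective pd pn k v X"
    \<comment> \<open>The bound 1 is arbitrary: \<open>S v + t\<close> is positive for every
      \<open>t > 0\<close>.\<close>
    unfolding eventually_at_right_field using S by (auto intro!: exI[of _ 1] pos)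
  ultimately have "G (S(v := S v + 0)) \<le> node_objective pd pn k v X"
    by (rule tendsto_upperbound) simp
  then show ?thesis by (simp add: G_def)
qed

lemma score_of_node_maximizer:
  fixes pd :: "('a::finite \<times> 'a) pmf" and X :: "'a \<Rightarrow> real ^ 'd::finite"
  assumes "1 \<le> k" and max: "maximizes (node_objective pd pn k v) X"
    and adm: "admissible_pair pd pn k u v"
  shows "X u \<bullet> X v = - ln (real k * pmf (pn v) u / pmf (node_conditional pd v) u)"
proof (rule ccontr)
  let ?a = "pmf (node_conditional pd v)" and ?b = "\<lambda>w. real k * pmf (pn v) w"
  let ?s = "- ln (?b u / ?a u)" and ?T = "\<lambda>w. X w \<bullet> X v"
  assume "X u \<bullet> X v \<noteq> ?s"
  have uv: "(u, v) \<in> set_pmf pd" "u \<in> set_pmf (pn v)" "u = v \<Longrightarrow> ?b u \<le> ?a u"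
    using adm by (auto simp: admissible_pair_def)
  have "set_pmf pd \<inter> {w. snd w = v} \<noteq> {}" using uv by auto
  then have "u \<in> set_pmf (node_conditional pd v)"
    using uv by (force simp: node_conditional_def)
  \<comment> \<open>Here \<open>k\<close> being at least 1 keeps the negative weight
    positive.\<close>
  then have ab: "0 < ?a u" "0 < ?b u" using uv(2) assms(1) by (simp_all add: pmf_positive)
  have less: "pair_loss (?a u) (?b u) (?T u) < pair_loss (?a u) (?b u) ?s"
    using ab \<open>X u \<bullet> X v \<noteq> ?s\<close> by (rule pair_loss_less_max)
  \<comment> \<open>For \<open>u \<noteq> v\<close> this entry is still the square
    \<open>X v \<bullet> X v\<close>; for \<open>u = v\<close> it is \<open>?s\<close>, nonnegative
    by the diagonal clause of \<open>admissible_pair\<close>.\<close>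
  have "0 \<le> (?T(u := ?s)) v" using uv(3) ab by (auto simp: ln_le_zero_iff)
  note sum_pair_loss_le_maximum[where S = "?T(u := ?s)", OF max this]
  moreover have "node_objective pd pn k v X <
      (\<Sum>w\<in>UNIV. pair_loss (?a w) (?b w) ((?T(u := ?s)) w))"
    unfolding node_objective_eq_sum
    by (rule sum_strict_mono_ex1) (use less in \<open>auto intro!: exI[of _ u]\<close>)
  ultimately show False by simp
qed

text \<open>The law of total expectation, obtained from the product rule for point masses.\<close>

lemma integral_node_conditional:
  fixes pd :: "('a::finite \<times> 'a) pmf" and f :: "'a \<times> 'a \<Rightarrow> real"
  shows "measure_pmf.expectation pd f = measure_pmf.expectation (node_marginal pd)
    (\<lambda>v. measure_pmf.expectation (node_conditional pd v) (\<lambda>u. f (u, v)))"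
proof -
  have cond: "pmf (node_marginal pd) v * pmf (node_conditional pd v) u = pmf pd (u, v)" for u v
  proof (cases "v \<in> set_pmf (node_marginal pd)")
    case True
    then have ne: "set_pmf pd \<inter> {w. snd w = v} \<noteq> {}" by (auto simp: node_marginal_def)
    \<comment> \<open>Given the condition, the second component is almost surely \<open>v\<close>,
      so the event that the first is \<open>u\<close> reduces to one pair.\<close>
    have "pmf (node_conditional pd v) u = pmf (cond_pmf pd {w. snd w = v}) (u, v)"
      unfolding node_conditional_def pmf_map
      using set_cond_pmf[OF ne]
      by (auto simp: measure_pmf_single[symmetric]
          intro!: measure_pmf.finite_measure_eq_AE AE_pmfI)
    also have "\<dots> = pmf pd (u, v) / pmf (node_marginal pd) v"
      using ne by (simp add: pmf_cond node_marginal_def pmf_map vimage_def)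
    finally show ?thesis using True by (simp add: set_pmf_iff)
  next
    \<comment> \<open>The conditional distribution is unspecified here, but both sides are
      zero.\<close>
    case False
    then have "(u, v) \<notin> set_pmf pd" by (force simp: node_marginal_def)
    with False show ?thesis by (simp add: set_pmf_iff)
  qed
  have "measure_pmf.expectation pd f = (\<Sum>(u, v)\<in>UNIV \<times> UNIV. pmf pd (u, v) * f (u, v))"
    by (simp add: integral_measure_pmf[of UNIV] split_beta)
  also have "\<dots> = (\<Sum>v\<in>UNIV. \<Sum>u\<in>UNIV. pmf pd (u, v) * f (u, v))"
    unfolding sum.cartesian_product[symmetric] by (rule sum.swap)
  finally show ?thesis
    by (simp add: integral_measure_pmf[of UNIV] sum_distrib_left mult.assoc[symmetric] cond)
qed

lemma objective_eq_expectation_node_objective: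
  fixes pd :: "('a::finite \<times> 'a) pmf" and X :: "'a \<Rightarrow> real ^ 'd::finite"
  shows "objective pd pn k X =
    measure_pmf.expectation (node_marginal pd) (\<lambda>v. node_objective pd pn k v X)"
  unfolding objective_def node_objective_def integral_node_conditional[of pd]
  by (simp add: integrable_measure_pmf_finite)

text \<open>If \<open>X\<close> fell short of the common maximizer \<open>Y\<close> at one node of
  positive weight, the weighted average would be strictly smaller for \<open>X\<close> than for
  \<open>Y\<close>.\<close>

lemma separately_maximizable_imp_maximizes_node_objective:
  fixes pd :: "('a::finite \<times> 'a) pmf" and X :: "'a \<Rightarrow> real ^ 'd::finite"
  assumes "separately_maximizable pd pn k TYPE('d)"
    and max: "maximizes (objective pd pn k) X" and v: "v \<in> set_pmf (node_marginal pd)"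
  shows "maximizes (node_objective pd pn k v) X"
proof -
  obtain Y :: "'a \<Rightarrow> real ^ 'd" where
    "\<forall>w\<in>set_pmf (node_marginal pd). maximizes (node_objective pd pn k w) Y"
    using assms(1) unfolding separately_maximizable_def by blast
  then have Y: "node_objective pd pn k w Z \<le> node_objective pd pn k w Y"
    if "w \<in> set_pmf (node_marginal pd)" for w and Z :: "'a \<Rightarrow> real ^ 'd"
    using that by (auto simp: maximizes_def is_arg_max_def not_less)
  have "node_objective pd pn k v Y \<le> node_objective pd pn k v X"
  proof (rule ccontr)
    assume less: "\<not> ?thesis"
    have "objective pd pn k X < objective pd pn k Y"
      unfolding objective_eq_expectation_node_objective integral_measure_pmf[of UNIV, OF finite UNIV_I]
    proof (rule sum_strict_mono_ex1)
      show "\<forall>w\<in>UNIV. pmf (node_marginal pd) w *\<^sub>R node_objective pd pn k w X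
          \<le> pmf (node_marginal pd) w *\<^sub>R node_objective pd pn k w Y"
        \<comment> \<open>Nothing is known about \<open>Y\<close> outside the support, where the
          weight is zero.\<close>
        using Y by (auto simp: set_pmf_iff mult_le_cancel_left)
      show "\<exists>w\<in>UNIV. pmf (node_marginal pd) w *\<^sub>R node_objective pd pn k w X
          < pmf (node_marginal pd) w *\<^sub>R node_objective pd pn k w Y"
        using less v by (auto intro!: exI[of _ v] simp: pmf_positive)
    qed simp
    then show False using max by (auto simp: maximizes_def is_arg_max_def)
  qed
  with Y[OF v] show ?thesis
    unfolding maximizes_def is_arg_max_def by (meson not_less order_trans)
qed

theorem theorem1:
  fixes pd :: "('a::finite \<times> 'a) pmf"
    and pn :: "'a \<Rightarrow> 'a pmf"
    and k :: nat
  assumes "k \<ge> 1"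
  shows
    "(\<forall>X :: 'a \<Rightarrow> real ^ 'd::finite.
        objective pd pn k X =
          measure_pmf.expectation (node_marginal pd) (\<lambda>v. node_objective pd pn k v X)) \<and>
     (\<forall>(X :: 'a \<Rightarrow> real ^ 'd) v. maximizes (node_objective pd pn k v) X \<longrightarrow>
        (\<forall>u. admissible_pair pd pn k u v \<longrightarrow>
           X u \<bullet> X v = - ln (real k * pmf (pn v) u / pmf (node_conditional pd v) u))) \<and>
     (separately_maximizable pd pn k TYPE('d) \<longrightarrow>
        (\<forall>X :: 'a \<Rightarrow> real ^ 'd. maximizes (objective pd pn k) X \<longrightarrow>
           (\<forall>u v. admissible_pair pd pn k u v \<longrightarrow>
              X u \<bullet> X v = - ln (real k * pmf (pn v) u / pmf (node_conditional pd v) u))))"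
proof (intro conjI allI impI)
  fix X :: "'a \<Rightarrow> real ^ 'd"
  show "objective pd pn k X =
      measure_pmf.expectation (node_marginal pd) (\<lambda>v. node_objective pd pn k v X)"
    by (rule objective_eq_expectation_node_objective)
next
  fix X :: "'a \<Rightarrow> real ^ 'd" and v u
  assume "maximizes (node_objective pd pn k v) X" "admissible_pair pd pn k u v"
  then show "X u \<bullet> X v = - ln (real k * pmf (pn v) u / pmf (node_conditional pd v) u)"
    by (rule score_of_node_maximizer[OF assms])
next
  fix X :: "'a \<Rightarrow> real ^ 'd" and u v
  assume max: "separately_maximizable pd pn k TYPE('d)" "maximizes (objective pd pn k) X"
    and adm: "admissible_pair pd pn k u v"
  \<comment> \<open>Optimality of the average says something only about nodes of positive marginal
    probability.\<close>
  have "v \<in> set_pmf (node_marginal pd)"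
    using adm by (force simp: admissible_pair_def node_marginal_def)
  with max have "maximizes (node_objective pd pn k v) X"
    by (rule separately_maximizable_imp_maximizes_node_objective)
  then show "X u \<bullet> X v = - ln (real k * pmf (pn v) u / pmf (node_conditional pd v) u)"
    using adm by (rule score_of_node_maximizer[OF assms])
qed

end
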